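(* Let $E_1,E_2$ be elliptic curves over $\mathbb{Q}$ without complex multiplication which are not isogenous over $\overline{\mathbb{Q}}$, let $A=E_1\times E_2$, and let $T\neq0$ be an integer. Then the infinite product over primes $$\prod_{\ell\nmid m_A}\frac{\ell^{v_\ell(T)+1}\,|H(\ell^{v_\ell(T)+1},T)|}{|H(\ell^{v_\ell(T)+1})|}$$ converges.
   Context: $G=\mathrm{GL}_2\times_{\det}\mathrm{GL}_2=\{(g_1,g_2):\det g_1=\det g_2\}$, $G(m)=G(\mathbb{Z}/m\mathbb{Z})$, and the trace of $(g_1,g_2)$ is $\operatorname{tr}g_1+\operatorname{tr}g_2$. $\rho_A:\mathrm{Gal}(\overline{\mathbb{Q}}/\mathbb{Q})\to G(\hat{\mathbb{Z}})$ is the representation on the torsion of $E_1$ and $E_2$; its image is open in $G(\hat{\mathbb{Z}})$ (Serre). $H(m)\subseteq G(m)$ is the image of $\rho_A$ modulo $m$, and $H(m,T)=\{h\in H(m):\operatorname{tr}h\equiv T\bmod m\}$. The conductor $m_A$ is the least positive integer $m$ such that the image of $\rho_A$ is the full preimage in $G(\hat{\mathbb{Z}})$ of $H(m)$. *)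

theory Defs
  imports
    "HOL-Algebra.Algebraic_Closure_Type"
    "HOL-Analysis.Analysis"
begin

section \<open>Elliptic curves as Weierstrass cubics\<close>

datatype 'a weierstrass =
  Weierstrass (coeff_a1: 'a) (coeff_a2: 'a) (coeff_a3: 'a) (coeff_a4: 'a) (coeff_a6: 'a)

definition discriminant :: "'a::field weierstrass \<Rightarrow> 'a" where
  "discriminant E =
    (let a1 = coeff_a1 E; a2 = coeff_a2 E; a3 = coeff_a3 E; a4 = coeff_a4 E; a6 = coeff_a6 E;
         b2 = a1^2 + 4 * a2; b4 = 2 * a4 + a1 * a3; b6 = a3^2 + 4 * a6;
         b8 = a1^2 * a6 + 4 * a2 * a6 - a1 * a3 * a4 + a2 * a3^2 - a4^2
     in - (b2^2 * b8) - 8 * b4^3 - 27 * b6^2 + 9 * b2 * b4 * b6)"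

definition elliptic_curve :: "'a::field weierstrass \<Rightarrow> bool" where
  "elliptic_curve E \<longleftrightarrow> discriminant E \<noteq> 0"

datatype 'a ec_point = Origin | Affine 'a 'a

fun on_curve :: "'a::field weierstrass \<Rightarrow> 'a ec_point \<Rightarrow> bool" where
  "on_curve E Origin \<longleftrightarrow> True"
| "on_curve E (Affine x y) \<longleftrightarrow>
     y^2 + coeff_a1 E * x * y + coeff_a3 E * y
       = x^3 + coeff_a2 E * x^2 + coeff_a4 E * x + coeff_a6 E"

definition curve_points :: "'a::field weierstrass \<Rightarrow> 'a ec_point set" where
  "curve_points E = {P. on_curve E P}"

fun ec_neg :: "'a::field weierstrass \<Rightarrow> 'a ec_point \<Rightarrow> 'a ec_point" where
  "ec_neg E Origin = Origin"
| "ec_neg E (Affine x y) = Affine x (- y - coeff_a1 E * x - coeff_a3 E)"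

text \<open>
  The chord-tangent law; the formula is meaningful for points on the curve.  If
  \<open>x1 = x2\<close> and the points are not opposite, then they coincide, and the slope is that
  of the tangent.
\<close>
fun ec_add :: "'a::field weierstrass \<Rightarrow> 'a ec_point \<Rightarrow> 'a ec_point \<Rightarrow> 'a ec_point" where
  "ec_add E Origin Q = Q"
| "ec_add E P Origin = P"
| "ec_add E (Affine x1 y1) (Affine x2 y2) =
    (if x1 = x2 \<and> y1 + y2 + coeff_a1 E * x2 + coeff_a3 E = 0 then Origin
     else
       let s = (if x1 = x2
                then (3 * x1^2 + 2 * coeff_a2 E * x1 + coeff_a4 E - coeff_a1 E * y1)
                       / (2 * y1 + coeff_a1 E * x1 + coeff_a3 E)
                else (y2 - y1) / (x2 - x1));
           x3 = s^2 + coeff_a1 E * s - coeff_a2 E - x1 - x2;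
           y3 = - (s * (x3 - x1) + y1) - coeff_a1 E * x3 - coeff_a3 E
       in Affine x3 y3)"

definition ec_mult :: "'a::field weierstrass \<Rightarrow> nat \<Rightarrow> 'a ec_point \<Rightarrow> 'a ec_point" where
  "ec_mult E n P = (ec_add E P ^^ n) Origin"

definition ec_zmult :: "'a::field weierstrass \<Rightarrow> int \<Rightarrow> 'a ec_point \<Rightarrow> 'a ec_point" where
  "ec_zmult E n P = (if n \<ge> 0 then ec_mult E (nat n) P else ec_neg E (ec_mult E (nat (- n)) P))"


section \<open>Isogenies over an algebraically closed field\<close>

text \<open>
  \<open>form_eval d c\<close> evaluates the ternary form of degree \<open>d\<close> in which the monomial
  \<open>X^i Y^j Z^(d - i - j)\<close> has coefficient \<open>c i j\<close>.
\<close>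
definition form_eval ::
    "nat \<Rightarrow> (nat \<Rightarrow> nat \<Rightarrow> 'a::field) \<Rightarrow> 'a \<times> 'a \<times> 'a \<Rightarrow> 'a" where
  "form_eval d c = (\<lambda>(x, y, z). \<Sum>i\<le>d. \<Sum>j\<le>d - i. c i j * x^i * y^j * z^(d - i - j))"

fun hom_coords :: "'a::field ec_point \<Rightarrow> 'a \<times> 'a \<times> 'a" where
  "hom_coords Origin = (0, 1, 0)"
| "hom_coords (Affine x y) = (x, y, 1)"

text \<open>
  A morphism of the projective curves, as a map on points: near every point it is given by
  three forms of the same degree without a common zero there.  A map on points determines
  the morphism because the field is algebraically closed.
\<close>
definition curve_morphism ::
    "'a::alg_closed_field weierstrass \<Rightarrow> 'a weierstrass \<Rightarrow> ('a ec_point \<Rightarrow> 'a ec_point) \<Rightarrow> bool"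
  where
  "curve_morphism E E' f \<longleftrightarrow>
     f ` curve_points E \<subseteq> curve_points E' \<and>
     (\<forall>P \<in> curve_points E. \<exists>d c1 c2 c3.
        let F = (\<lambda>Q. (form_eval d c1 (hom_coords Q), form_eval d c2 (hom_coords Q),
                       form_eval d c3 (hom_coords Q)))
        in F P \<noteq> (0, 0, 0) \<and>
           (\<forall>Q \<in> curve_points E. F Q \<noteq> (0, 0, 0) \<longrightarrow>
              (\<exists>t. F Q = (case hom_coords (f Q) of (x, y, z) \<Rightarrow> (t * x, t * y, t * z)))))"

definition isogeny ::
    "'a::alg_closed_field weierstrass \<Rightarrow> 'a weierstrass \<Rightarrow> ('a ec_point \<Rightarrow> 'a ec_point) \<Rightarrow> bool"
  where
  "isogeny E E' f \<longleftrightarrow> curve_morphism E E' f \<and> f Origin = Origin"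

text \<open>The constant map to the origin is allowed in \<open>isogeny\<close>; it is excluded here.\<close>
definition isogenous :: "'a::alg_closed_field weierstrass \<Rightarrow> 'a weierstrass \<Rightarrow> bool" where
  "isogenous E E' \<longleftrightarrow> (\<exists>f. isogeny E E' f \<and> (\<exists>P \<in> curve_points E. f P \<noteq> Origin))"

definition complex_multiplication :: "'a::alg_closed_field weierstrass \<Rightarrow> bool" where
  "complex_multiplication E \<longleftrightarrow>
     (\<exists>f. isogeny E E f \<and> \<not> (\<exists>n::int. \<forall>P \<in> curve_points E. f P = ec_zmult E n P))"


section \<open>Galois action on torsion\<close>

type_synonym qbar = "rat alg_closure"

type_synonym mat2 = "int^2^2"

definition base_change :: "rat weierstrass \<Rightarrow> qbar weierstrass" where
  "base_change E = map_weierstrass to_ac E"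

definition absolute_galois_group :: "(qbar \<Rightarrow> qbar) set" where
  "absolute_galois_group =
     {\<sigma>. bij \<sigma> \<and> (\<forall>x y. \<sigma> (x + y) = \<sigma> x + \<sigma> y) \<and> (\<forall>x y. \<sigma> (x * y) = \<sigma> x * \<sigma> y) \<and>
         (\<forall>q. \<sigma> (to_ac q) = to_ac q)}"

definition torsion_points :: "rat weierstrass \<Rightarrow> nat \<Rightarrow> qbar ec_point set" where
  "torsion_points E n =
     {P \<in> curve_points (base_change E). ec_mult (base_change E) n P = Origin}"

definition residue_vectors :: "nat \<Rightarrow> (int^2) set" where
  "residue_vectors n = {v. \<forall>i. v $ i \<in> {0..<int n}}"

definition torsion_comb ::
    "rat weierstrass \<Rightarrow> (2 \<Rightarrow> qbar ec_point) \<Rightarrow> int^2 \<Rightarrow> qbar ec_point" where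
  "torsion_comb E b v =
     ec_add (base_change E) (ec_zmult (base_change E) (v $ 1) (b 1))
                            (ec_zmult (base_change E) (v $ 2) (b 2))"

text \<open>
  A basis of the full Tate module (the inverse limit of the \<open>n\<close>-torsion groups) over the
  profinite integers, given as a compatible system of bases of the \<open>n\<close>-torsion groups over
  the integers modulo \<open>n\<close>.
\<close>
definition tate_basis :: "rat weierstrass \<Rightarrow> (nat \<Rightarrow> 2 \<Rightarrow> qbar ec_point) \<Rightarrow> bool" where
  "tate_basis E B \<longleftrightarrow>
     (\<forall>n>0. bij_betw (torsion_comb E (B n)) (residue_vectors n) (torsion_points E n)) \<and>
     (\<forall>n>0. \<forall>m. m dvd n \<longrightarrow> (\<forall>j. ec_mult (base_change E) (n div m) (B n j) = B m j))"

text \<open>The matrix of \<open>\<sigma>\<close> on the \<open>n\<close>-torsion: column \<open>j\<close> holds the coordinates of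
  the image of the \<open>j\<close>-th basis point.\<close>
definition galois_matrix ::
    "rat weierstrass \<Rightarrow> (nat \<Rightarrow> 2 \<Rightarrow> qbar ec_point) \<Rightarrow> (qbar \<Rightarrow> qbar) \<Rightarrow> nat \<Rightarrow> mat2" where
  "galois_matrix E B \<sigma> n =
     (\<chi> i j. the_inv_into (residue_vectors n) (torsion_comb E (B n)) (map_ec_point \<sigma> (B n j)) $ i)"


section \<open>The group of pairs of matrices with equal determinant\<close>

text \<open>Integers modulo \<open>n\<close> are represented by their residues in \<open>{0..<n}\<close>, for \<open>n > 0\<close>.\<close>
definition GL2_mod :: "nat \<Rightarrow> mat2 set" where
  "GL2_mod n = {A. (\<forall>i j. A $ i $ j \<in> {0..<int n}) \<and> coprime (det A) (int n)}"

definition G_mod :: "nat \<Rightarrow> (mat2 \<times> mat2) set" where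
  "G_mod n = {(g1, g2). g1 \<in> GL2_mod n \<and> g2 \<in> GL2_mod n \<and> det g1 mod int n = det g2 mod int n}"

definition mat_mod :: "nat \<Rightarrow> mat2 \<Rightarrow> mat2" where
  "mat_mod n A = (\<chi> i j. A $ i $ j mod int n)"

text \<open>Points over the profinite integers, as the inverse limit of the groups \<open>G_mod n\<close>.\<close>
definition G_hat :: "(nat \<Rightarrow> mat2 \<times> mat2) set" where
  "G_hat = {g \<in> (\<Pi>\<^sub>E n\<in>{0<..}. G_mod n).
     \<forall>n>0. \<forall>m. m dvd n \<longrightarrow> g m = map_prod (mat_mod m) (mat_mod m) (g n)}"

definition pair_trace :: "mat2 \<times> mat2 \<Rightarrow> int" where
  "pair_trace g = trace (fst g) + trace (snd g)"


section \<open>The adelic representation of a product of two curves\<close>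

text \<open>
  Another choice of bases conjugates all images below by a pair of invertible matrices, which
  preserves determinants and traces; the conductor and the cardinalities of \<open>H\<close> and
  \<open>H_trace\<close> do not change.
\<close>
locale curve_pair =
  fixes E1 E2 :: "rat weierstrass"
    and B1 B2 :: "nat \<Rightarrow> 2 \<Rightarrow> qbar ec_point"
begin

definition rho :: "(qbar \<Rightarrow> qbar) \<Rightarrow> nat \<Rightarrow> mat2 \<times> mat2" where
  "rho \<sigma> = (\<lambda>n\<in>{0<..}. (galois_matrix E1 B1 \<sigma> n, galois_matrix E2 B2 \<sigma> n))"

definition rho_image :: "(nat \<Rightarrow> mat2 \<times> mat2) set" where
  "rho_image = rho ` absolute_galois_group"

definition H :: "nat \<Rightarrow> (mat2 \<times> mat2) set" where
  "H m = (\<lambda>g. g m) ` rho_image"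

definition H_trace :: "nat \<Rightarrow> int \<Rightarrow> (mat2 \<times> mat2) set" where
  "H_trace m T = {h \<in> H m. pair_trace h mod int m = T mod int m}"

definition full_preimage_level :: "nat \<Rightarrow> bool" where
  "full_preimage_level m \<longleftrightarrow> m > 0 \<and> rho_image = {g \<in> G_hat. g m \<in> H m}"

text \<open>
  The conductor is a predicate because some level exists exactly if \<open>rho_image\<close> is an
  open subgroup of \<open>G_hat\<close>, which is Serre's theorem.
\<close>
definition is_conductor :: "nat \<Rightarrow> bool" where
  "is_conductor m \<longleftrightarrow> full_preimage_level m \<and> (\<forall>m'. full_preimage_level m' \<longrightarrow> m \<le> m')"

definition euler_factor :: "int \<Rightarrow> nat \<Rightarrow> real" where
  "euler_factor T l =
     (let q = l ^ (multiplicity (int l) T + 1)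
      in real q * real (card (H_trace q T)) / real (card (H q)))"

end

end

theory Submission
  imports Defs "HOL-Number_Theory.Cong"
begin

text \<open>
  For a prime \<open>l\<close> not dividing the conductor, \<open>H l\<close> is all of \<open>G_mod l\<close>: an element of
  \<open>G_mod l\<close> has an integer lift with equal determinants, and this lift can replace the
  \<open>l\<close>-component of any element of the adelic image without changing the component at the
  conductor.  The number of \<open>2 \<times> 2\<close> matrices over the field with \<open>l\<close> elements of trace \<open>t\<close> and
  determinant \<open>d\<close> is \<open>l^2 + e t d\<close> with \<open>\<bar>e t d\<bar> \<le> l\<close> and \<open>\<Sum>d. e t d = 0\<close>.  Summing
  products of two such counts over \<open>t\<close> and \<open>d \<noteq> 0\<close>, the terms linear in \<open>e\<close> nearly cancel, so
  every trace fibre of \<open>G_mod l\<close> has \<open>l^6 - l^5 + O(l^4)\<close> elements, uniformly in the trace.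
  Hence the factor at \<open>l\<close> is \<open>1 + O(1 / l^2)\<close> for all but finitely many \<open>l\<close>; the finitely many
  primes dividing \<open>T\<close> play no role.
\<close>

no_notation fps_nth (infixl \<open>$\<close> 75)

subsection \<open>Matrices of given trace and determinant\<close>

lemma cong_prime_solve_unique:
  fixes l b k :: int
  assumes "prime l" and "\<not> l dvd b"
  shows "\<exists>!c. c \<in> {0..<l} \<and> [b * c = k] (mod l)"
proof -
  have cop: "coprime b l"
    using prime_imp_coprime[OF assms] by (simp add: coprime_commute)
  have l0: "l > 0" using assms(1) by (simp add: prime_gt_0_int)
  obtain u where u: "[b * u = 1] (mod l)"
    using cong_solve_coprime_int[OF cop] by auto
  have "[b * (u * k) = k] (mod l)"
    using cong_scalar_right[OF u, of k] by (simp add: mult.assoc)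
  hence ex: "[b * ((u * k) mod l) = k] (mod l)"
    by (simp add: cong_def mod_mult_right_eq)
  show ?thesis
  proof (rule ex1I)
    show "(u * k) mod l \<in> {0..<l} \<and> [b * ((u * k) mod l) = k] (mod l)"
      using ex l0 by simp
  next
    fix c assume c: "c \<in> {0..<l} \<and> [b * c = k] (mod l)"
    hence "[b * c = b * ((u * k) mod l)] (mod l)"
      using ex cong_sym cong_trans by blast
    hence "[c = (u * k) mod l] (mod l)"
      using cop by (simp add: cong_mult_lcancel)
    thus "c = (u * k) mod l" using c by (simp add: cong_def)
  qed
qed

lemma card_eq_sum_card_fibres:
  assumes "finite A" "finite B" "f ` A \<subseteq> B"
  shows "card A = (\<Sum>b\<in>B. card {a \<in> A. f a = b})"
  using sum.group[OF assms, of "\<lambda>_. 1::nat"] by simp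

text \<open>Each of the \<open>l - 1\<close> nonzero values of \<open>b\<close> is invertible and so
  determines \<open>c\<close>. For \<open>b = 0\<close> every \<open>c\<close> is a solution if
  \<open>l\<close> divides \<open>k\<close>, and none is otherwise.\<close>

lemma card_prod_eq_residues:
  fixes l :: nat and k :: int
  assumes "prime l"
  shows "card {(b, c). b \<in> {0..<int l} \<and> c \<in> {0..<int l} \<and> [b * c = k] (mod int l)}
           = l - 1 + (if int l dvd k then l else 0)"
proof -
  let ?S = "{0..<int l}"
  have l0: "l > 0" using assms prime_gt_0_nat by blast
  have "?S = insert 0 {1..<int l}" using l0 by auto
  hence split: "sum g ?S = g 0 + sum g {1..<int l}" for g :: "int \<Rightarrow> nat"
    by (simp only: sum.insert finite_atLeastLessThan_int) simp
  have "card {(b, c). b \<in> ?S \<and> c \<in> ?S \<and> [b * c = k] (mod int l)}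
     = card (SIGMA b:?S. {c \<in> ?S. [b * c = k] (mod int l)})"
    by (rule arg_cong[where f = card]) auto
  also have "\<dots> = (\<Sum>b\<in>?S. card {c \<in> ?S. [b * c = k] (mod int l)})"
  proof (rule card_SigmaI)
    show "\<forall>b\<in>?S. finite {c \<in> ?S. [b * c = k] (mod int l)}"
      by (intro ballI finite_subset[OF Collect_restrict]) simp
  qed simp
  also have "(\<Sum>b\<in>?S. card {c \<in> ?S. [b * c = k] (mod int l)})
     = card {c \<in> ?S. [0 * c = k] (mod int l)} +
       (\<Sum>b\<in>{1..<int l}. card {c \<in> ?S. [b * c = k] (mod int l)})"
    by (rule split)
  also have "(\<Sum>b\<in>{1..<int l}. card {c \<in> ?S. [b * c = k] (mod int l)}) = (\<Sum>b\<in>{1..<int l}. 1)"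
  proof (rule sum.cong[OF refl])
    fix b assume "b \<in> {1..<int l}"
    hence "\<not> int l dvd b" using zdvd_not_zless[of b "int l"] by auto
    have "prime (int l)" using assms by simp
    from cong_prime_solve_unique[OF this \<open>\<not> int l dvd b\<close>, of k]
    obtain c where c: "c \<in> ?S \<and> [b * c = k] (mod int l)"
      and unique: "\<forall>x. x \<in> ?S \<and> [b * x = k] (mod int l) \<longrightarrow> x = c"
      by (rule ex1E)
    have "{c \<in> ?S. [b * c = k] (mod int l)} = {c}"
    proof (intro subset_antisym subsetI)
      fix x assume "x \<in> {c \<in> ?S. [b * c = k] (mod int l)}"
      hence "x \<in> ?S \<and> [b * x = k] (mod int l)" by (rule CollectD)
      thus "x \<in> {c}" using unique by simp
    next
      fix x assume "x \<in> {c}"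
      hence "x = c" by (rule singletonD)
      thus "x \<in> {c \<in> ?S. [b * c = k] (mod int l)}" using c by (intro CollectI) (simp only:)
    qed
    thus "card {c \<in> ?S. [b * c = k] (mod int l)} = 1" by simp
  qed
  also have "\<dots> = l - 1" by simp
  also have "card {c \<in> ?S. [0 * c = k] (mod int l)} = (if int l dvd k then l else 0)"
    unfolding mult_zero_left cong_sym_eq[of 0 k] cong_0_iff
    by (cases "int l dvd k") (simp_all only: simp_thms Collect_mem_eq card_atLeastLessThan_int, simp_all)
  finally show ?thesis by simp
qed

text \<open>Two solutions \<open>x\<close> and \<open>a\<close> satisfy
  \<open>(x - a) * (t - a - x) = 0\<close> modulo \<open>l\<close>. As \<open>l\<close> is prime,
  \<open>x\<close> is \<open>a\<close> or \<open>t - a\<close>.\<close>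

lemma card_quadratic_roots_le_2:
  fixes l :: nat and t d :: int
  assumes "prime l"
  shows "card {a \<in> {0..<int l}. [a * (t - a) = d] (mod int l)} \<le> 2" (is "card ?R \<le> 2")
proof (cases "?R = {}")
  case False
  then obtain a where a: "a \<in> ?R" by blast
  have "?R \<subseteq> {a, (t - a) mod int l}"
  proof
    fix x assume x: "x \<in> ?R"
    have "[x * (t - x) = a * (t - a)] (mod int l)"
      using a x cong_sym cong_trans by blast
    hence "int l dvd x * (t - x) - a * (t - a)" by (simp add: cong_iff_dvd_diff)
    also have "x * (t - x) - a * (t - a) = (x - a) * (t - a - x)" by (simp add: algebra_simps)
    finally have "int l dvd x - a \<or> int l dvd t - a - x"
      using assms prime_dvd_mult_iff[of "int l"] by simp
    hence "[x = a] (mod int l) \<or> [t - a = x] (mod int l)" by (simp add: cong_iff_dvd_diff)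
    thus "x \<in> {a, (t - a) mod int l}" using a x by (auto simp: cong_def)
  qed
  hence "card ?R \<le> card {a, (t - a) mod int l}" by (intro card_mono) auto
  also have "\<dots> \<le> 2" by (simp add: card_insert_if)
  finally show ?thesis .
next
  case True
  show ?thesis unfolding True by simp
qed

lemma prime_int_coprime_iff_not_dvd:
  assumes "prime l"
  shows "coprime x (int l) \<longleftrightarrow> \<not> int l dvd x"
proof
  show "coprime x (int l)" if "\<not> int l dvd x"
    using prime_imp_coprime[OF _ that] assms by (simp add: coprime_commute)
  show "\<not> int l dvd x" if "coprime x (int l)"
  proof
    assume "int l dvd x"
    with that have "is_unit (int l)" by (meson coprime_common_divisor dvd_refl)
    thus False using assms by auto
  qed
qed

section \<open>Residue matrices and the sizes of their trace-determinant classes\<close>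

definition residue_mats :: "nat \<Rightarrow> mat2 set" where
  "residue_mats n = {A. \<forall>i j. A $ i $ j \<in> {0..<int n}}"

text \<open>The parameters are arbitrary integers read modulo \<open>n\<close>, so that
  \<open>T - t\<close> can be inserted later without reduction.\<close>

definition trace_det_class :: "nat \<Rightarrow> int \<Rightarrow> int \<Rightarrow> mat2 set" where
  "trace_det_class n t d =
     {A \<in> residue_mats n. [trace A = t] (mod int n) \<and> [det A = d] (mod int n)}"

lemma trace_2: "trace (A :: 'a::semiring_1^2^2) = A $ 1 $ 1 + A $ 2 $ 2"
  by (simp add: trace_def sum_2)

lemma mat2_eq_iff:
  "(A :: 'a^2^2) = B \<longleftrightarrow>
     A $ 1 $ 1 = B $ 1 $ 1 \<and> A $ 1 $ 2 = B $ 1 $ 2 \<and> A $ 2 $ 1 = B $ 2 $ 1 \<and> A $ 2 $ 2 = B $ 2 $ 2"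
  by (simp add: vec_eq_iff forall_2 conj_assoc)

definition mat2_of :: "'a::zero \<Rightarrow> 'a \<Rightarrow> 'a \<Rightarrow> 'a \<Rightarrow> 'a^2^2" where
  "mat2_of a b c d = vector [vector [a, b], vector [c, d]]"

lemma mat2_of_nth [simp]:
  "mat2_of a b c d $ 1 $ 1 = a" "mat2_of a b c d $ 1 $ 2 = b"
  "mat2_of a b c d $ 2 $ 1 = c" "mat2_of a b c d $ 2 $ 2 = d"
  by (simp_all add: mat2_of_def)

text \<open>The trace fixes the residue of the lower right entry, and the other three entries are
  free.\<close>

lemma bij_betw_trace_class:
  fixes n :: nat
  assumes "n > 0"
  shows "bij_betw (\<lambda>A. (A $ 1 $ 1, A $ 1 $ 2, A $ 2 $ 1))
           {A \<in> residue_mats n. [trace A = t] (mod int n)}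
           ({0..<int n} \<times> {0..<int n} \<times> {0..<int n})"
proof (rule bij_betw_byWitness[where f' = "\<lambda>(a, b, c). mat2_of a b c ((t - a) mod int n)"])
  have *: "(t - a) mod int n = e" if "(a + e) mod int n = t mod int n" "0 \<le> e" "e < int n" for a e
  proof -
    have "(t - a) mod int n = ((a + e) - a) mod int n"
      using that(1) by (metis mod_diff_left_eq)
    thus ?thesis using that by simp
  qed
  show "\<forall>A\<in>{A \<in> residue_mats n. [trace A = t] (mod int n)}.
      (\<lambda>(a, b, c). mat2_of a b c ((t - a) mod int n)) (A $ 1 $ 1, A $ 1 $ 2, A $ 2 $ 1) = A"
    by (simp add: residue_mats_def forall_2 mat2_eq_iff trace_2 cong_def *)
  show "(\<lambda>(a, b, c). mat2_of a b c ((t - a) mod int n)) `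
      ({0..<int n} \<times> {0..<int n} \<times> {0..<int n})
      \<subseteq> {A \<in> residue_mats n. [trace A = t] (mod int n)}"
    using assms by (auto simp: residue_mats_def forall_2 trace_2 cong_def mod_add_right_eq)
qed (auto simp: residue_mats_def)

lemma finite_residue_mats: "finite (residue_mats n)"
proof (rule finite_imageD)
  show "finite ((\<lambda>A. (A $ 1 $ 1, A $ 1 $ 2, A $ 2 $ 1, A $ 2 $ 2)) ` residue_mats n)"
    by (rule finite_subset[of _ "{0..<int n} \<times> {0..<int n} \<times> {0..<int n} \<times> {0..<int n}"])
       (auto simp: residue_mats_def)
qed (auto simp: inj_on_def mat2_eq_iff)

text \<open>With diagonal entries \<open>a\<close> and \<open>t - a\<close>, the determinant
  condition says that the off-diagonal entries have product \<open>a * (t - a) - d\<close>. There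
  are \<open>l - 1\<close> such pairs, and \<open>l\<close> more exactly when \<open>a\<close> is a
  root of \<open>a * (t - a) = d\<close>; summing over \<open>a\<close> gives the formula.\<close>

lemma card_trace_det_class:
  assumes "prime l"
  shows "card (trace_det_class l t d)
           = l * (l - 1) + l * card {a \<in> {0..<int l}. [a * (t - a) = d] (mod int l)}"
proof -
  let ?S = "{0..<int l}"
  let ?f = "\<lambda>A::mat2. (A $ 1 $ 1, A $ 1 $ 2, A $ 2 $ 1)"
  have l0: "l > 0" using assms prime_gt_0_nat by blast
  have det: "[det A = d] (mod int l) \<longleftrightarrow>
      [A $ 1 $ 2 * A $ 2 $ 1 = A $ 1 $ 1 * (t - A $ 1 $ 1) - d] (mod int l)"
    if A: "[trace A = t] (mod int l)" for A :: mat2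
  proof -
    have *: "int l dvd A $ 1 $ 1 + A $ 2 $ 2 - t"
      using A by (simp add: cong_iff_dvd_diff trace_2)
    have eq: "det A - d = A $ 1 $ 1 * (A $ 1 $ 1 + A $ 2 $ 2 - t)
        - (A $ 1 $ 2 * A $ 2 $ 1 - (A $ 1 $ 1 * (t - A $ 1 $ 1) - d))"
      by (simp add: det_2 algebra_simps)
    have "int l dvd det A - d \<longleftrightarrow>
        int l dvd A $ 1 $ 2 * A $ 2 $ 1 - (A $ 1 $ 1 * (t - A $ 1 $ 1) - d)"
      unfolding eq by (rule dvd_diff_right_iff) (rule dvd_mult[OF *])
    thus ?thesis by (simp add: cong_iff_dvd_diff)
  qed
  note bij = bij_betw_trace_class[OF l0, of t]
  have "card (trace_det_class l t d) = card (?f ` trace_det_class l t d)"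
    by (rule card_image[symmetric], rule inj_on_subset[OF bij_betw_imp_inj_on[OF bij]])
       (auto simp: trace_det_class_def)
  also have "?f ` trace_det_class l t d =
      (SIGMA a:?S. {(b, c). b \<in> ?S \<and> c \<in> ?S \<and> [b * c = a * (t - a) - d] (mod int l)})" (is "_ = ?R")
  proof (intro subset_antisym subsetI)
    fix x assume "x \<in> ?f ` trace_det_class l t d"
    then obtain A where A: "A \<in> residue_mats l" "[trace A = t] (mod int l)" "[det A = d] (mod int l)"
      and x: "x = ?f A"
      by (auto simp: trace_det_class_def)
    show "x \<in> ?R"
      using A(1) iffD1[OF det[OF A(2)] A(3)] unfolding x by (simp add: residue_mats_def)
  next
    fix x assume x: "x \<in> ?R"
    hence "x \<in> ?S \<times> ?S \<times> ?S" by blast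
    hence "x \<in> ?f ` {A \<in> residue_mats l. [trace A = t] (mod int l)}"
      unfolding bij_betw_imp_surj_on[OF bij] .
    then obtain A where A: "A \<in> residue_mats l" "[trace A = t] (mod int l)" and xA: "x = ?f A"
      by blast
    have "[det A = d] (mod int l)"
      using x unfolding det[OF A(2)] xA by simp
    thus "x \<in> ?f ` trace_det_class l t d"
      unfolding xA trace_det_class_def using A by blast
  qed
  also have "card ?R = (\<Sum>a\<in>?S. card {(b, c). b \<in> ?S \<and> c \<in> ?S \<and> [b * c = a * (t - a) - d] (mod int l)})"
  proof (rule card_SigmaI)
    have fin: "finite {(b, c). b \<in> ?S \<and> c \<in> ?S \<and> P b c}" for P :: "int \<Rightarrow> int \<Rightarrow> bool"
      by (rule finite_subset[of _ "?S \<times> ?S"]) auto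
    show "\<forall>a\<in>?S. finite {(b, c). b \<in> ?S \<and> c \<in> ?S \<and> [b * c = a * (t - a) - d] (mod int l)}"
      by (rule ballI) (rule fin)
  qed simp
  also have "\<dots> = (\<Sum>a\<in>?S. l - 1 + (if int l dvd a * (t - a) - d then l else 0))"
    by (intro sum.cong refl card_prod_eq_residues[OF assms])
  also have "\<dots> = l * (l - 1) + l * card {a \<in> ?S. [a * (t - a) = d] (mod int l)}"
    unfolding sum.distrib cong_iff_dvd_diff
    by (simp only: sum.inter_filter[symmetric] finite_atLeastLessThan_int sum_constant
        card_atLeastLessThan_int diff_zero nat_int mult.commute of_nat_id)
  finally show ?thesis .
qed

text \<open>If \<open>r\<close> is the number of roots, the class has
  \<open>l ^ 2 + l * (r - 1)\<close> elements, and \<open>r\<close> is 0, 1 or 2.\<close>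

lemma card_trace_det_class_bound:
  assumes "prime l"
  shows "\<bar>real (card (trace_det_class l t d)) - real l ^ 2\<bar> \<le> real l"
proof -
  define r where "r = card {a \<in> {0..<int l}. [a * (t - a) = d] (mod int l)}"
  have "r \<le> 2" unfolding r_def by (rule card_quadratic_roots_le_2[OF assms])
  hence r: "\<bar>real r - 1\<bar> \<le> 1" by auto
  have "l \<ge> 1" using assms prime_ge_1_nat by blast
  hence l1: "real (l - 1) = real l - 1" by (simp add: of_nat_diff)
  have "real (card (trace_det_class l t d)) = real l * (real l - 1) + real l * real r"
    unfolding card_trace_det_class[OF assms] r_def of_nat_add of_nat_mult l1 ..
  hence "real (card (trace_det_class l t d)) - real l ^ 2 = real l * (real r - 1)"
    by (simp add: power2_eq_square algebra_simps)
  thus ?thesis using mult_left_mono[OF r, of "real l"] by (simp add: abs_mult)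
qed

text \<open>The determinant partitions the matrices of trace \<open>t\<close>, which are
  parametrised by three free entries.\<close>

lemma sum_card_trace_det_class:
  assumes "l > 0"
  shows "(\<Sum>d\<in>{0..<int l}. card (trace_det_class l t d)) = l ^ 3"
proof -
  let ?A = "{A \<in> residue_mats l. [trace A = t] (mod int l)}"
  have "card ?A = (\<Sum>d\<in>{0..<int l}. card {A \<in> ?A. det A mod int l = d})"
    by (rule card_eq_sum_card_fibres) (use assms in \<open>auto simp: finite_residue_mats\<close>)
  also have "\<dots> = (\<Sum>d\<in>{0..<int l}. card (trace_det_class l t d))"
    by (intro sum.cong refl arg_cong[where f = card]) (auto simp: trace_det_class_def cong_def)
  finally show ?thesis
    using bij_betw_same_card[OF bij_betw_trace_class[OF assms, of t]]
    by (simp add: power3_eq_cube)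
qed

subsection \<open>Trace fibres of the group\<close>

text \<open>This is what \<open>H_trace\<close> becomes at a level where \<open>H\<close> is all of
  \<open>G_mod\<close>.\<close>

definition G_trace :: "nat \<Rightarrow> int \<Rightarrow> (mat2 \<times> mat2) set" where
  "G_trace n T = {g \<in> G_mod n. pair_trace g mod int n = T mod int n}"

lemma finite_G_mod: "finite (G_mod n)"
proof (rule finite_subset)
  show "G_mod n \<subseteq> residue_mats n \<times> residue_mats n"
    by (auto simp: G_mod_def GL2_mod_def residue_mats_def)
qed (simp add: finite_residue_mats)

lemma finite_G_trace: "finite (G_trace n T)"
  by (simp add: G_trace_def finite_G_mod)

lemma card_G_mod_eq_sum:
  assumes "l > 0"
  shows "card (G_mod l) = (\<Sum>T\<in>{0..<int l}. card (G_trace l T))"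
proof -
  have "card (G_mod l) = (\<Sum>T\<in>{0..<int l}. card {g \<in> G_mod l. pair_trace g mod int l = T})"
    by (rule card_eq_sum_card_fibres) (use assms in \<open>auto simp: finite_G_mod\<close>)
  thus ?thesis by (simp add: G_trace_def)
qed

text \<open>The fibre is sorted by the common determinant \<open>d\<close> and the trace
  \<open>t\<close> of the first matrix; the second matrix then has trace \<open>T - t\<close>. The
  sum starts at \<open>d = 1\<close> because invertibility modulo the prime \<open>l\<close> means
  nonzero determinant.\<close>

lemma card_G_trace_eq_sum:
  assumes "prime l"
  shows "card (G_trace l T) = (\<Sum>d\<in>{1..<int l}. \<Sum>t\<in>{0..<int l}.
           card (trace_det_class l t d) * card (trace_det_class l (T - t) d))"
proof -
  have l0: "l > 0" using assms prime_gt_0_nat by blast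
  let ?f = "\<lambda>g::mat2 \<times> mat2. (det (fst g) mod int l, trace (fst g) mod int l)"
  have cop: "coprime x (int l) \<longleftrightarrow> x mod int l \<noteq> 0" for x
    unfolding prime_int_coprime_iff_not_dvd[OF assms] dvd_eq_mod_eq_0 ..
  have "card (G_trace l T) = (\<Sum>x\<in>{1..<int l} \<times> {0..<int l}. card {g \<in> G_trace l T. ?f g = x})"
  proof (rule card_eq_sum_card_fibres)
    have "det A mod int l \<ge> 1" if "coprime (det A) (int l)" for A :: mat2
    proof -
      have "det A mod int l \<ge> 0" using l0 by simp
      thus ?thesis using that by (auto simp: cop)
    qed
    thus "?f ` G_trace l T \<subseteq> {1..<int l} \<times> {0..<int l}"
      using l0 by (auto simp: G_trace_def G_mod_def GL2_mod_def)
  qed (auto simp: finite_G_trace)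
  also have "\<dots> = (\<Sum>(d, t)\<in>{1..<int l} \<times> {0..<int l}.
           card (trace_det_class l t d) * card (trace_det_class l (T - t) d))"
  proof (rule sum.cong[OF refl], clarify)
    fix d t assume d: "d \<in> {1..<int l}" and t: "t \<in> {0..<int l}"
    have dt: "d mod int l = d" "t mod int l = t" "d \<noteq> 0" using d t by auto
    have trc: "(x + y) mod int l = T mod int l \<longleftrightarrow> y mod int l = (T - t) mod int l"
      if "x mod int l = t" for x y
    proof -
      have "int l dvd x - t"
        using that dt(2) mod_eq_dvd_iff[of x "int l" t] by simp
      hence "int l dvd (x - t) + (y - (T - t)) \<longleftrightarrow> int l dvd y - (T - t)"
        by (rule dvd_add_right_iff)
      moreover have "(x - t) + (y - (T - t)) = x + y - T" by simp
      ultimately show ?thesis by (simp only: mod_eq_dvd_iff)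
    qed
    have "{g \<in> G_trace l T. ?f g = (d, t)} = trace_det_class l t d \<times> trace_det_class l (T - t) d"
    proof (intro Set.set_eqI)
      fix g :: "mat2 \<times> mat2"
      obtain A B where g: "g = (A, B)" by (cases g)
      have "A \<in> residue_mats l \<and> B \<in> residue_mats l \<and> det A mod int l \<noteq> 0 \<and> det B mod int l \<noteq> 0 \<and>
          det A mod int l = det B mod int l \<and> (trace A + trace B) mod int l = T mod int l \<and>
          det A mod int l = d \<and> trace A mod int l = t \<longleftrightarrow>
        A \<in> residue_mats l \<and> B \<in> residue_mats l \<and> trace A mod int l = t \<and> det A mod int l = d \<and>
          trace B mod int l = (T - t) mod int l \<and> det B mod int l = d"
        using trc[of "trace A" "trace B"] dt(3) by metis
      thus "g \<in> {g \<in> G_trace l T. ?f g = (d, t)} \<longleftrightarrow>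
          g \<in> trace_det_class l t d \<times> trace_det_class l (T - t) d"
        unfolding g mem_Collect_eq mem_Times_iff fst_conv snd_conv prod.inject G_trace_def G_mod_def
          GL2_mod_def trace_det_class_def residue_mats_def pair_trace_def cong_def cop dt(1,2)
          prod.case by argo
    qed
    thus "card {g \<in> G_trace l T. ?f g = (d, t)}
        = card (trace_det_class l t d) * card (trace_det_class l (T - t) d)"
      by (simp add: card_cartesian_product)
  qed
  also have "\<dots> = (\<Sum>d\<in>{1..<int l}. \<Sum>t\<in>{0..<int l}.
           card (trace_det_class l t d) * card (trace_det_class l (T - t) d))"
    by (simp add: sum.cartesian_product)
  finally show ?thesis .
qed

text \<open>Expanding \<open>(l ^ 2 + e t d) * (l ^ 2 + e (T - t) d)\<close> gives three sums: the
  constant terms yield \<open>l ^ 6 - l ^ 5\<close>, the linear terms at most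
  \<open>2 * l ^ 4\<close> in absolute value, and the quadratic terms at most
  \<open>l ^ 4\<close>.\<close>

lemma card_G_trace_bound:
  assumes "prime l"
  shows "\<bar>real (card (G_trace l T)) - (real l ^ 6 - real l ^ 5)\<bar> \<le> 3 * real l ^ 4"
proof -
  define e where "e = (\<lambda>t d. real (card (trace_det_class l t d)) - real l ^ 2)"
  let ?S = "{0..<int l}" and ?D = "{1..<int l}"
  have l0: "l > 0" using assms prime_gt_0_nat by blast
  have e: "\<bar>e t d\<bar> \<le> real l" for t d
    unfolding e_def by (rule card_trace_det_class_bound[OF assms])
  have S: "?S = insert 0 ?D" using l0 by auto
  have cS: "real (card ?S) = real l" by simp
  have cD: "real (card ?D) = real l - 1" using l0 by (simp add: of_nat_diff)
  \<comment> \<open>This cancellation saves a factor \<open>l\<close>: over all determinants the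
    errors add up to 0, so over the nonzero ones only the term at \<open>d = 0\<close> survives,
    with the opposite sign. Bounding each linear term separately would leave an error of order
    \<open>l ^ 5\<close>.\<close>
  have sum_e: "(\<Sum>d\<in>?D. e t d) = - e t 0" for t
  proof -
    have "real (\<Sum>d\<in>?S. card (trace_det_class l t d)) = real l ^ 3"
      by (simp only: sum_card_trace_det_class[OF l0] of_nat_power)
    hence "(\<Sum>d\<in>?S. e t d) = 0"
      unfolding e_def by (simp add: sum_subtractf power3_eq_cube power2_eq_square)
    thus ?thesis by (simp add: S)
  qed
  have "real (card (G_trace l T)) = (\<Sum>d\<in>?D. \<Sum>t\<in>?S. (real l ^ 2 + e t d) * (real l ^ 2 + e (T - t) d))"
    by (simp add: card_G_trace_eq_sum[OF assms] e_def)
  also have "\<dots> = (\<Sum>d\<in>?D. \<Sum>t\<in>?S. real l ^ 4 + real l ^ 2 * (e t d + e (T - t) d) + e t d * e (T - t) d)"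
    by (intro sum.cong refl) (simp add: algebra_simps power2_eq_square power4_eq_xxxx)
  also have "\<dots> = (\<Sum>d\<in>?D. \<Sum>t\<in>?S. real l ^ 4) + real l ^ 2 * (\<Sum>d\<in>?D. \<Sum>t\<in>?S. e t d + e (T - t) d)
       + (\<Sum>d\<in>?D. \<Sum>t\<in>?S. e t d * e (T - t) d)"
    by (simp only: sum.distrib sum_distrib_left distrib_left)
  also have "(\<Sum>d\<in>?D. \<Sum>t\<in>?S. real l ^ 4) = real l ^ 6 - real l ^ 5"
    unfolding sum_constant cD cS by (simp add: eval_nat_numeral left_diff_distrib)
  also have "(\<Sum>d\<in>?D. \<Sum>t\<in>?S. e t d + e (T - t) d) = (\<Sum>t\<in>?S. - (e t 0 + e (T - t) 0))"
    by (subst sum.swap) (simp add: sum.distrib sum_e)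
  finally have eq: "real (card (G_trace l T)) - (real l ^ 6 - real l ^ 5)
     = real l ^ 2 * (\<Sum>t\<in>?S. - (e t 0 + e (T - t) 0)) + (\<Sum>d\<in>?D. \<Sum>t\<in>?S. e t d * e (T - t) d)"
    by simp
  define P where "P = (\<Sum>t\<in>?S. - (e t 0 + e (T - t) 0))"
  define Q where "Q = (\<Sum>d\<in>?D. \<Sum>t\<in>?S. e t d * e (T - t) d)"
  have "\<bar>P\<bar> \<le> (\<Sum>t\<in>?S. 2 * real l)"
    unfolding P_def
  proof (rule order_trans[OF sum_abs], rule sum_mono)
    fix t show "\<bar>- (e t 0 + e (T - t) 0)\<bar> \<le> 2 * real l"
      using e[of t 0] e[of "T - t" 0] by linarith
  qed
  hence "\<bar>P\<bar> \<le> 2 * real l ^ 2"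
    by (simp add: power2_eq_square)
  hence "real l ^ 2 * \<bar>P\<bar> \<le> real l ^ 2 * (2 * real l ^ 2)"
    by (rule mult_left_mono) simp
  hence 1: "\<bar>real l ^ 2 * P\<bar> \<le> 2 * real l ^ 4"
    by (simp add: abs_mult power2_eq_square power4_eq_xxxx mult_ac)
  have "\<bar>Q\<bar> \<le> (\<Sum>d\<in>?D. \<Sum>t\<in>?S. real l ^ 2)"
    unfolding Q_def
  proof (rule order_trans[OF sum_abs], rule sum_mono, rule order_trans[OF sum_abs], rule sum_mono)
    fix d t show "\<bar>e t d * e (T - t) d\<bar> \<le> real l ^ 2"
      unfolding abs_mult power2_eq_square by (intro mult_mono e) auto
  qed
  also have "\<dots> = (real l - 1) * real l ^ 3"
    unfolding sum_constant cD cS by (simp add: power2_eq_square power3_eq_cube)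
  also have "\<dots> \<le> real l ^ 4"
    by (simp add: left_diff_distrib power3_eq_cube power4_eq_xxxx)
  finally show ?thesis using 1 eq unfolding P_def[symmetric] Q_def[symmetric] by linarith
qed

text \<open>Each fibre lies within \<open>3 * x ^ 4\<close> of the same value \<open>M\<close>, so
  both \<open>x\<close> times one fibre and the whole group, a union of \<open>l\<close> fibres, lie
  within \<open>3 * x ^ 5\<close> of \<open>x * M\<close>. Their difference is at most
  \<open>6 * x ^ 5\<close>, to be divided by a group order of at least
  \<open>x ^ 7 / 2\<close>.\<close>

lemma G_trace_ratio_bound:
  assumes "prime l" and "l \<ge> 4"
  shows "\<bar>real l * real (card (G_trace l T)) / real (card (G_mod l)) - 1\<bar> \<le> 12 / real l ^ 2"
proof -
  define x where "x = real l"
  define M where "M = x ^ 6 - x ^ 5"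
  define N where "N = (\<lambda>T. real (card (G_trace l T)))"
  define g where "g = real (card (G_mod l))"
  have x: "x \<ge> 4" using assms by (simp add: x_def)
  have N: "\<bar>N T - M\<bar> \<le> 3 * x ^ 4" for T
    unfolding N_def M_def x_def by (rule card_G_trace_bound[OF assms(1)])
  have "g = (\<Sum>T\<in>{0..<int l}. N T)"
    using assms(2) by (simp add: g_def N_def card_G_mod_eq_sum)
  hence "g - x * M = (\<Sum>T\<in>{0..<int l}. N T - M)"
    by (simp add: sum_subtractf x_def)
  also have "\<bar>\<dots>\<bar> \<le> (\<Sum>T\<in>{0..<int l}. 3 * x ^ 4)"
    by (rule order_trans[OF sum_abs], rule sum_mono, rule N)
  finally have g: "\<bar>g - x * M\<bar> \<le> 3 * x ^ 5" by (simp add: x_def eval_nat_numeral)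
  have "\<bar>x * (N T - M)\<bar> \<le> x * (3 * x ^ 4)"
    unfolding abs_mult using x by (intro mult_mono N) auto
  hence xN: "\<bar>x * N T - x * M\<bar> \<le> 3 * x ^ 5"
    by (simp add: eval_nat_numeral right_diff_distrib)
  \<comment> \<open>The expression equals \<open>x ^ 2 - 2 * x - 6\<close>. Multiplied by
    \<open>x ^ 5\<close> it is twice the difference \<open>x * M - 3 * x ^ 5 - x ^ 7 / 2\<close>,
    and in this form its sign for \<open>x \<ge> 4\<close> is evident.\<close>
  have "0 \<le> (x - 4) * (x + 2) + 2" using x by (intro add_nonneg_nonneg mult_nonneg_nonneg) auto
  hence "0 \<le> x ^ 5 * ((x - 4) * (x + 2) + 2)" using x by (intro mult_nonneg_nonneg) auto
  hence "x ^ 7 / 2 \<le> x * M - 3 * x ^ 5"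
    unfolding M_def by (simp add: algebra_simps eval_nat_numeral)
  hence gl: "x ^ 7 / 2 \<le> g" using g by linarith
  have x7: "x ^ 7 > 0" using x by simp
  hence g0: "g > 0" using gl by linarith
  have "\<bar>x * N T / g - 1\<bar> = \<bar>x * N T - g\<bar> / g"
    using g0 by (simp add: field_simps)
  also have "\<dots> \<le> (6 * x ^ 5) / (x ^ 7 / 2)"
    using xN g gl x7 by (intro frac_le) auto
  also have "\<dots> = 12 / x ^ 2" using x by (simp add: field_simps eval_nat_numeral)
  finally show ?thesis by (simp add: x_def N_def g_def)
qed

subsection \<open>Surjectivity at primes not dividing the level\<close>

definition mat_cong :: "int \<Rightarrow> mat2 \<Rightarrow> mat2 \<Rightarrow> bool" where
  "mat_cong n A B \<longleftrightarrow> (\<forall>i j. [A $ i $ j = B $ i $ j] (mod n))"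

lemma mat_cong_det: "mat_cong n A B \<Longrightarrow> [det A = det B] (mod n)"
  unfolding mat_cong_def det_2 by (intro cong_diff cong_mult) auto

lemma mat_cong_refl: "mat_cong n A A"
  by (simp add: mat_cong_def)

lemma mat_cong_sym: "mat_cong n A B \<Longrightarrow> mat_cong n B A"
  unfolding mat_cong_def by (simp add: cong_sym)

lemma mat_cong_trans: "mat_cong n A B \<Longrightarrow> mat_cong n B C \<Longrightarrow> mat_cong n A C"
  unfolding mat_cong_def using cong_trans by blast

lemma mat_mod_mat_cong: "mat_cong (int n) (mat_mod n A) A"
  by (simp add: mat_cong_def mat_mod_def cong_def)

lemma mat_mod_eq_iff: "mat_mod n A = mat_mod n B \<longleftrightarrow> mat_cong (int n) A B"
  by (simp add: mat_cong_def mat_mod_def cong_def vec_eq_iff)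

lemma mat_mod_idem: "(\<And>i j. A $ i $ j \<in> {0..<int n}) \<Longrightarrow> mat_mod n A = A"
  by (simp add: mat_mod_def vec_eq_iff)

section \<open>Integer lifts of matrices with prescribed determinant\<close>

text \<open>Completing a coprime bottom row to a matrix of prescribed determinant is Bezout's identity.\<close>
lemma int_lift_coprime_row:
  fixes a b c d D q :: int
  assumes "coprime c d" and "[a * d - b * c = D] (mod q)"
  shows "\<exists>a' b'. [a' = a] (mod q) \<and> [b' = b] (mod q) \<and> a' * d - b' * c = D"
proof -
  obtain m where m: "D - (a * d - b * c) = q * m"
    using cong_sym[OF assms(2)] unfolding cong_iff_dvd_diff by (rule dvdE)
  obtain u v where uv: "u * c + v * d = 1"
    using bezout_int[of c d] assms(1) by auto
  have "(a + q * (m * v)) * d - (b - q * (m * u)) * c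
      = (a * d - b * c) + q * m * (u * c + v * d)"
    by (simp add: algebra_simps)
  also have "\<dots> = D" using uv m by simp
  finally show ?thesis
    by (intro exI[of _ "a + q * (m * v)"] exI[of _ "b - q * (m * u)"])
       (simp add: cong_iff_dvd_diff)
qed

text \<open>An entry prime to \<open>l\<close> is kept, and the Chinese remainder theorem moves the
  other one within its class modulo \<open>l\<close> so that it is 1 modulo the kept entry.\<close>

lemma coprime_row_lift:
  fixes l :: nat and c d :: int
  assumes "prime l" and "\<not> (int l dvd c \<and> int l dvd d)"
  shows "\<exists>c' d'. [c' = c] (mod int l) \<and> [d' = d] (mod int l) \<and> coprime c' d'"
proof (cases "int l dvd d")
  case False
  hence "coprime (int l) d"
    unfolding coprime_commute[of "int l"] prime_int_coprime_iff_not_dvd[OF assms(1)] .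
  from binary_chinese_remainder_int[OF this, of c 1] obtain c' where
    c': "[c' = c] (mod int l)" "[c' = 1] (mod d)" by (elim exE conjE)
  have cop: "coprime c' d"
    by (rule cong_imp_coprime[OF cong_sym[OF c'(2)]]) simp
  show ?thesis
    by (rule exI[of _ c'], rule exI[of _ d]) (simp only: c'(1) cop cong_refl simp_thms)
next
  case True
  hence "\<not> int l dvd c" using assms(2) by simp
  hence "coprime (int l) c"
    unfolding coprime_commute[of "int l"] prime_int_coprime_iff_not_dvd[OF assms(1)] .
  from binary_chinese_remainder_int[OF this, of d 1] obtain d' where
    d': "[d' = d] (mod int l)" "[d' = 1] (mod c)" by (elim exE conjE)
  have "coprime d' c"
    by (rule cong_imp_coprime[OF cong_sym[OF d'(2)]]) simp
  hence cop: "coprime c d'" by (simp only: coprime_commute)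
  show ?thesis
    by (rule exI[of _ c], rule exI[of _ d']) (simp only: d'(1) cop cong_refl simp_thms)
qed

text \<open>The determinant is a unit modulo \<open>l\<close>, so the bottom row is nonzero there
  and lifts to a coprime row; the top row is then adjusted to reach the determinant \<open>D\<close>
  exactly.\<close>

lemma int_lift_det:
  assumes "prime l" and "coprime (det B) (int l)" and "[det B = D] (mod int l)"
  obtains B' where "mat_cong (int l) B' B" "det B' = D"
proof -
  have "\<not> (int l dvd B $ 2 $ 1 \<and> int l dvd B $ 2 $ 2)"
  proof
    assume "int l dvd B $ 2 $ 1 \<and> int l dvd B $ 2 $ 2"
    hence "int l dvd det B" unfolding det_2 by (intro dvd_diff dvd_mult) simp_all
    thus False using assms(2) prime_int_coprime_iff_not_dvd[OF assms(1), of "det B"] by blast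
  qed
  from coprime_row_lift[OF assms(1) this] obtain c d where
    cd: "[c = B $ 2 $ 1] (mod int l)" "[d = B $ 2 $ 2] (mod int l)" "coprime c d"
    by (elim exE conjE)
  have "[B $ 1 $ 1 * d - B $ 1 $ 2 * c = B $ 1 $ 1 * B $ 2 $ 2 - B $ 1 $ 2 * B $ 2 $ 1] (mod int l)"
    using cd by (intro cong_diff cong_mult cong_refl)
  hence "[B $ 1 $ 1 * d - B $ 1 $ 2 * c = D] (mod int l)"
    by (rule cong_trans[OF _ assms(3)[unfolded det_2]])
  from int_lift_coprime_row[OF cd(3) this] obtain a b where
    "[a = B $ 1 $ 1] (mod int l)" "[b = B $ 1 $ 2] (mod int l)" "a * d - b * c = D"
    by (elim exE conjE)
  with cd show ?thesis
    by (intro that[of "mat2_of a b c d"]) (auto simp: mat_cong_def forall_2 det_2)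
qed

section \<open>Splitting a modulus at a prime, and gluing matrices along the two parts\<close>

definition prime_to_part :: "nat \<Rightarrow> nat \<Rightarrow> nat" where
  "prime_to_part l n = n div l ^ multiplicity l n"

context
  fixes l :: nat
  assumes l: "prime l"
begin

lemma prime_to_part_decomp: "n = l ^ multiplicity l n * prime_to_part l n"
  by (simp add: prime_to_part_def multiplicity_dvd)

lemma parts_dvd: "l ^ multiplicity l n dvd n" "prime_to_part l n dvd n"
  using dvd_triv_right[of "prime_to_part l n" "l ^ multiplicity l n"]
  unfolding prime_to_part_decomp[of n, symmetric] by (simp_all add: multiplicity_dvd)

lemma int_prime_to_part_decomp:
  "int n = int (l ^ multiplicity l n) * int (prime_to_part l n)"
  by (rule trans[OF arg_cong[OF prime_to_part_decomp[of n], of int] of_nat_mult])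

lemma coprime_prime_to_part:
  assumes "n > 0"
  shows "coprime (l ^ k) (prime_to_part l n)"
proof -
  have "\<not> is_unit l" using l not_prime_unit by blast
  hence "\<not> l dvd prime_to_part l n"
    unfolding prime_to_part_def
    using assms by (intro multiplicity_decompose) simp_all
  from prime_imp_coprime[OF l this] show ?thesis by simp
qed

lemma prime_to_part_dvd:
  assumes "n > 0" and "m dvd n"
  shows "prime_to_part l m dvd prime_to_part l n"
proof -
  have m: "m > 0" using assms dvd_pos_nat by blast
  have "prime_to_part l m dvd l ^ multiplicity l n * prime_to_part l n"
    using parts_dvd(2) assms(2) dvd_trans unfolding prime_to_part_decomp[of n, symmetric] by blast
  moreover have "coprime (prime_to_part l m) (l ^ multiplicity l n)"
    by (subst coprime_commute) (rule coprime_prime_to_part[OF m])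
  ultimately show ?thesis by (simp only: coprime_dvd_mult_right_iff)
qed

lemma cong_iff_cong_parts:
  assumes "n > 0"
  shows "[x = y] (mod int n) \<longleftrightarrow>
    [x = y] (mod int (l ^ multiplicity l n)) \<and> [x = y] (mod int (prime_to_part l n))"
proof -
  have "coprime (int (l ^ multiplicity l n)) (int (prime_to_part l n))"
    using coprime_prime_to_part[OF assms] by (simp only: coprime_int_iff)
  moreover have "int (l ^ multiplicity l n) dvd int n" "int (prime_to_part l n) dvd int n"
    unfolding of_nat_dvd_iff by (rule parts_dvd)+
  ultimately show ?thesis
    using coprime_cong_mult[of x y "int (l ^ multiplicity l n)" "int (prime_to_part l n)"]
      cong_dvd_modulus[of x y "int n"]
    unfolding int_prime_to_part_decomp[of n, symmetric] by iprover
qed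

text \<open>The idempotent modulo \<open>n\<close> that projects onto the
  \<open>l\<close>-part.\<close>

definition crt_idem :: "nat \<Rightarrow> int" where
  "crt_idem n = (SOME e. [e = 1] (mod int (l ^ multiplicity l n)) \<and> [e = 0] (mod int (prime_to_part l n)))"

lemma crt_idem:
  assumes "n > 0"
  shows "[crt_idem n = 1] (mod int (l ^ multiplicity l n))" "[crt_idem n = 0] (mod int (prime_to_part l n))"
proof -
  have "coprime (int (l ^ multiplicity l n)) (int (prime_to_part l n))"
    using coprime_prime_to_part[OF assms] by (simp only: coprime_int_iff)
  from someI_ex[OF binary_chinese_remainder_int[OF this, of 1 0]]
  show "[crt_idem n = 1] (mod int (l ^ multiplicity l n))" "[crt_idem n = 0] (mod int (prime_to_part l n))"
    unfolding crt_idem_def by blast+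
qed

text \<open>The matrix modulo \<open>n\<close> that agrees with \<open>U\<close> on the
  \<open>l\<close>-part and with \<open>Y\<close> on the part prime to \<open>l\<close>. An integer
  matrix \<open>U\<close> can serve at all levels \<open>n\<close> at once and thus stands for a
  matrix over the \<open>l\<close>-adic integers.\<close>

definition glue :: "nat \<Rightarrow> mat2 \<Rightarrow> mat2 \<Rightarrow> mat2" where
  "glue n U Y = mat_mod n (\<chi> i j. crt_idem n * U $ i $ j + (1 - crt_idem n) * Y $ i $ j)"

lemma glue_cong:
  assumes "n > 0"
  shows "mat_cong (int (l ^ multiplicity l n)) (glue n U Y) U"
    and "mat_cong (int (prime_to_part l n)) (glue n U Y) Y"
proof -
  let ?Z = "\<chi> i j. crt_idem n * U $ i $ j + (1 - crt_idem n) * Y $ i $ j"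
  have c: "[glue n U Y $ i $ j = crt_idem n * U $ i $ j + (1 - crt_idem n) * Y $ i $ j] (mod int n)" for i j
    using mat_mod_mat_cong[of n ?Z] by (simp add: glue_def mat_cong_def)
  note c' = c[unfolded cong_iff_cong_parts[OF assms]]
  have "[crt_idem n * U $ i $ j + (1 - crt_idem n) * Y $ i $ j = 1 * U $ i $ j + (1 - 1) * Y $ i $ j]
      (mod int (l ^ multiplicity l n))" for i j
    by (intro cong_add cong_mult cong_diff cong_refl crt_idem(1)[OF assms])
  from cong_trans[OF conjunct1[OF c'] this]
  show "mat_cong (int (l ^ multiplicity l n)) (glue n U Y) U"
    by (simp add: mat_cong_def)
  have "[crt_idem n * U $ i $ j + (1 - crt_idem n) * Y $ i $ j = 0 * U $ i $ j + (1 - 0) * Y $ i $ j]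
      (mod int (prime_to_part l n))" for i j
    by (intro cong_add cong_mult cong_diff cong_refl crt_idem(2)[OF assms])
  from cong_trans[OF conjunct2[OF c'] this]
  show "mat_cong (int (prime_to_part l n)) (glue n U Y) Y"
    by (simp add: mat_cong_def)
qed

text \<open>By the Chinese remainder theorem the two congruences determine the matrix modulo
  \<open>n\<close>, and both sides have reduced entries. Glued matrices can thus be identified
  without computing the idempotent.\<close>

lemma glue_unique:
  assumes "n > 0" and "\<And>i j. Z $ i $ j \<in> {0..<int n}"
    and "mat_cong (int (l ^ multiplicity l n)) Z U" and "mat_cong (int (prime_to_part l n)) Z Y"
  shows "glue n U Y = Z"
proof -
  have "mat_cong (int n) (glue n U Y) Z"
    unfolding mat_cong_def cong_iff_cong_parts[OF assms(1)]
    using mat_cong_trans[OF glue_cong(1)[OF assms(1)] mat_cong_sym[OF assms(3)]]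
      mat_cong_trans[OF glue_cong(2)[OF assms(1)] mat_cong_sym[OF assms(4)]]
    unfolding mat_cong_def by simp
  hence "mat_mod n (glue n U Y) = mat_mod n Z" by (simp add: mat_mod_eq_iff)
  moreover have "mat_mod n (glue n U Y) = glue n U Y"
    using assms(1) by (intro mat_mod_idem) (simp add: glue_def mat_mod_def)
  ultimately show ?thesis using mat_mod_idem[OF assms(2)] by simp
qed

lemma mat_cong_dvd: "mat_cong n A B \<Longrightarrow> m dvd n \<Longrightarrow> mat_cong m A B"
  unfolding mat_cong_def using cong_dvd_modulus by blast

text \<open>This is the compatibility that an element of the inverse limit requires. The two parts
  of \<open>m\<close> divide those of \<open>n\<close>, so the reduction satisfies the congruences
  that characterise gluing at level \<open>m\<close>.\<close>

lemma mat_mod_glue: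
  assumes "n > 0" and "m dvd n"
  shows "mat_mod m (glue n U Y) = glue m U (mat_mod m Y)"
proof -
  have m: "m > 0" using assms dvd_pos_nat by blast
  have d1: "int (l ^ multiplicity l m) dvd int (l ^ multiplicity l n)"
    using assms by (simp add: le_imp_power_dvd dvd_imp_multiplicity_le)
  have d2: "int (prime_to_part l m) dvd int (prime_to_part l n)"
    using prime_to_part_dvd[OF assms] by simp
  have d3: "int (l ^ multiplicity l m) dvd int m" "int (prime_to_part l m) dvd int m"
    unfolding of_nat_dvd_iff by (rule parts_dvd)+
  show ?thesis
  proof (rule glue_unique[OF m, symmetric])
    show "mat_mod m (glue n U Y) $ i $ j \<in> {0..<int m}" for i j
      using m by (simp add: mat_mod_def)
    show "mat_cong (int (l ^ multiplicity l m)) (mat_mod m (glue n U Y)) U"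
      by (rule mat_cong_trans[OF mat_cong_dvd[OF mat_mod_mat_cong d3(1)]
            mat_cong_dvd[OF glue_cong(1)[OF assms(1)] d1]])
    show "mat_cong (int (prime_to_part l m)) (mat_mod m (glue n U Y)) (mat_mod m Y)"
      by (rule mat_cong_trans[OF mat_cong_trans[OF mat_cong_dvd[OF mat_mod_mat_cong d3(2)]
            mat_cong_dvd[OF glue_cong(2)[OF assms(1)] d2]]
            mat_cong_sym[OF mat_cong_dvd[OF mat_mod_mat_cong d3(2)]]])
  qed
qed

lemma glue_det_cong:
  assumes "n > 0"
  shows "[det (glue n U Y) = det U] (mod int (l ^ multiplicity l n))"
    and "[det (glue n U Y) = det Y] (mod int (prime_to_part l n))"
  using glue_cong[OF assms] mat_cong_det by blast+

text \<open>Invertibility and equality of determinants are checked on the two parts of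
  \<open>n\<close>. The determinants of \<open>U1\<close> and \<open>U2\<close> are equal as
  integers because \<open>n\<close> may contain any power of \<open>l\<close>.\<close>

lemma glue_G_mod:
  assumes n: "n > 0" and Y: "(Y1, Y2) \<in> G_mod n"
    and U: "det U1 = det U2" "coprime (det U1) (int l)"
  shows "(glue n U1 Y1, glue n U2 Y2) \<in> G_mod n"
proof -
  have GL2: "glue n U Z \<in> GL2_mod n" if "coprime (det U) (int l)" "Z \<in> GL2_mod n" for U Z
  proof -
    have "coprime (det U) (int (l ^ multiplicity l n))" using that(1) by simp
    hence 1: "coprime (det (glue n U Z)) (int (l ^ multiplicity l n))"
      by (rule cong_imp_coprime[OF cong_sym[OF glue_det_cong(1)[OF n]]])
    have "coprime (det Z) (int n)" using that(2) by (simp add: GL2_mod_def)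
    moreover have "int (prime_to_part l n) dvd int n"
      using parts_dvd by simp
    ultimately have "coprime (det Z) (int (prime_to_part l n))"
      by (rule coprime_divisors[OF dvd_refl, rotated])
    hence 2: "coprime (det (glue n U Z)) (int (prime_to_part l n))"
      by (rule cong_imp_coprime[OF cong_sym[OF glue_det_cong(2)[OF n]]])
    have "coprime (det (glue n U Z)) (int (l ^ multiplicity l n) * int (prime_to_part l n))"
      using 1 2 by (simp only: coprime_mult_right_iff)
    hence "coprime (det (glue n U Z)) (int n)"
      unfolding int_prime_to_part_decomp[of n, symmetric] .
    thus ?thesis using n by (simp add: GL2_mod_def glue_def mat_mod_def)
  qed
  have "[det Y1 = det Y2] (mod int n)" using Y by (simp add: G_mod_def cong_def)
  hence "[det Y1 = det Y2] (mod int (prime_to_part l n))"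
    unfolding cong_iff_cong_parts[OF n] by (rule conjunct2)
  hence "[det (glue n U1 Y1) = det (glue n U2 Y2)] (mod int (prime_to_part l n))"
    by (rule cong_trans[OF cong_trans[OF glue_det_cong(2)[OF n]]
          cong_sym[OF glue_det_cong(2)[OF n]]])
  moreover have "[det (glue n U1 Y1) = det (glue n U2 Y2)] (mod int (l ^ multiplicity l n))"
    using cong_trans[OF glue_det_cong(1)[OF n, of U1 Y1] cong_sym[OF glue_det_cong(1)[OF n, of U2 Y2, folded U(1)]]] .
  ultimately have "[det (glue n U1 Y1) = det (glue n U2 Y2)] (mod int n)"
    unfolding cong_iff_cong_parts[OF n] by (rule conjI[rotated])
  thus ?thesis
    using GL2 U Y by (auto simp: G_mod_def cong_def)
qed

end

section \<open>Changing the component of a profinite point at one prime\<close>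

lemma G_hatD:
  assumes "g \<in> G_hat" and "n > 0"
  shows "g n \<in> G_mod n"
    and "m dvd n \<Longrightarrow> g m = map_prod (mat_mod m) (mat_mod m) (g n)"
proof -
  note g = CollectD[OF assms(1)[unfolded G_hat_def]]
  show "g n \<in> G_mod n" by (rule PiE_mem[OF conjunct1[OF g]]) (simp add: assms(2))
  show "m dvd n \<Longrightarrow> g m = map_prod (mat_mod m) (mat_mod m) (g n)"
    by (rule conjunct2[OF g, rule_format, OF assms(2)])
qed

lemma G_hatI:
  assumes "\<And>n. n > 0 \<Longrightarrow> g n \<in> G_mod n" and "g \<in> extensional {0<..}"
    and "\<And>m n. n > 0 \<Longrightarrow> m dvd n \<Longrightarrow> g m = map_prod (mat_mod m) (mat_mod m) (g n)"
  shows "g \<in> G_hat"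
  unfolding G_hat_def PiE_iff mem_Collect_eq
  by (intro conjI ballI allI impI assms) simp_all

text \<open>
  An integer lift of \<open>x\<close> with equal determinants is an element over the \<open>l\<close>-adic integers,
  which replaces the \<open>l\<close>-component of \<open>g\<close>.
\<close>
lemma G_hat_replace_component:
  assumes l: "prime l" and g: "g \<in> G_hat" and x: "x \<in> G_mod l"
  obtains h where "h \<in> G_hat" "h l = x" "\<And>m. m > 0 \<Longrightarrow> \<not> l dvd m \<Longrightarrow> h m = g m"
proof -
  obtain A B where AB: "x = (A, B)" by (cases x)
  have gG: "g n \<in> G_mod n" if "n > 0" for n
    using G_hatD(1)[OF g that] .
  have gm: "g m = map_prod (mat_mod m) (mat_mod m) (g n)" if "n > 0" "m dvd n" for m n
    using G_hatD(2)[OF g that] .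
  have A: "coprime (det A) (int l)" and B: "coprime (det B) (int l)"
    and "[det B = det A] (mod int l)"
    using x by (auto simp: AB G_mod_def GL2_mod_def cong_def)
  \<comment> \<open>The residue matrix \<open>A\<close> serves as its own integer lift; only
    \<open>B\<close> has to be moved, to a lift with determinant exactly
    \<open>det A\<close>.\<close>
  from int_lift_det[OF l B this(3)] obtain B' where B': "mat_cong (int l) B' B" "det B' = det A" .
  have l0: "l > 0" using l prime_gt_0_nat by blast
  define h where "h = (\<lambda>n\<in>{0<..}. (glue l n A (fst (g n)), glue l n B' (snd (g n))))"
  have h: "h n = (glue l n A (fst (g n)), glue l n B' (snd (g n)))" if "n > 0" for n
    using that by (simp add: h_def)
  have "h \<in> G_hat"
  proof (rule G_hatI)
    show "h n \<in> G_mod n" if n: "n > 0" for n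
    proof -
      have "(fst (g n), snd (g n)) \<in> G_mod n" using gG[OF n] by simp
      from glue_G_mod[OF l n this B'(2)[symmetric] A] show ?thesis unfolding h[OF n] .
    qed
    show "h m = map_prod (mat_mod m) (mat_mod m) (h n)" if n: "n > 0" "m dvd n" for m n
    proof -
      have m: "m > 0" using n dvd_pos_nat by blast
      show ?thesis
        unfolding h[OF m] h[OF n(1)] gm[OF n] fst_map_prod snd_map_prod map_prod_simp
          mat_mod_glue[OF l n] ..
    qed
    show "h \<in> extensional {0<..}" unfolding h_def by simp
  qed
  moreover have "h l = x"
  proof -
    \<comment> \<open>At level \<open>l\<close> the part prime to \<open>l\<close> is 1, so only the
      lifts matter.\<close>
    have "multiplicity l l = 1" using l l0 by (simp add: not_prime_unit)
    hence parts: "int (l ^ multiplicity l l) = int l" "int (prime_to_part l l) = 1"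
      using l0 by (simp_all add: prime_to_part_def)
    have trivial: "mat_cong 1 Z Y" for Z Y by (simp add: mat_cong_def)
    have AB_mod: "A $ i $ j \<in> {0..<int l}" "B $ i $ j \<in> {0..<int l}" for i j
      using x by (simp_all add: AB G_mod_def GL2_mod_def)
    have "glue l l A (fst (g l)) = A"
      by (rule glue_unique[OF l l0 AB_mod(1)]) (simp_all only: parts trivial mat_cong_refl)
    moreover have "glue l l B' (snd (g l)) = B"
      by (rule glue_unique[OF l l0 AB_mod(2)]) (simp_all only: parts trivial mat_cong_sym[OF B'(1)])
    ultimately show ?thesis using l0 by (simp add: h AB)
  qed
  moreover have "h m = g m" if m: "m > 0" "\<not> l dvd m" for m
  proof -
    \<comment> \<open>At a level prime to \<open>l\<close> the \<open>l\<close>-part is 1, so only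
      the component of \<open>g\<close> matters.\<close>
    have "multiplicity l m = 0" using m(2) by (rule not_dvd_imp_multiplicity_0)
    hence parts: "int (l ^ multiplicity l m) = 1" "int (prime_to_part l m) = int m"
      by (simp_all add: prime_to_part_def)
    have trivial: "mat_cong 1 Z Y" for Z Y by (simp add: mat_cong_def)
    have g_mod: "fst (g m) $ i $ j \<in> {0..<int m}" "snd (g m) $ i $ j \<in> {0..<int m}" for i j
      using gG[OF m(1)] by (auto simp: G_mod_def GL2_mod_def)
    have "glue l m A (fst (g m)) = fst (g m)"
      by (rule glue_unique[OF l m(1) g_mod(1)]) (simp_all only: parts trivial mat_cong_refl)
    moreover have "glue l m B' (snd (g m)) = snd (g m)"
      by (rule glue_unique[OF l m(1) g_mod(2)]) (simp_all only: parts trivial mat_cong_refl)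
    ultimately show ?thesis using m by (simp add: h)
  qed
  ultimately show thesis by (rule that)
qed

section \<open>The image at primes not dividing the level, and the Euler factors there\<close>

text \<open>Membership of a profinite point in the image depends only on its component at
  \<open>m\<close>. Replacing the \<open>l\<close>-component of a point of the image by any
  \<open>x\<close> leaves that component unchanged, so the new point is again in the image and
  \<open>x\<close> is in \<open>H l\<close>.\<close>

lemma (in curve_pair) H_eq_G_mod:
  assumes "full_preimage_level m" and l: "prime l" "\<not> l dvd m"
  shows "H l = G_mod l"
proof -
  have m: "m > 0" and im: "rho_image = {g \<in> G_hat. g m \<in> H m}"
    using assms(1) by (auto simp: full_preimage_level_def)
  have l0: "l > 0" using l prime_gt_0_nat by blast
  \<comment> \<open>The identity automorphism supplies a point of the image to be modified.\<close>
  have "id \<in> absolute_galois_group" by (simp add: absolute_galois_group_def)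
  hence "rho id \<in> rho_image" by (simp add: rho_image_def)
  hence g: "rho id \<in> G_hat" "rho id m \<in> H m" using im by auto
  show ?thesis
  proof
    show "H l \<subseteq> G_mod l"
    proof
      fix x assume "x \<in> H l"
      then obtain h where "h \<in> rho_image" "x = h l" by (auto simp: H_def)
      hence "h \<in> G_hat" "x = h l" using im by auto
      thus "x \<in> G_mod l" using G_hatD(1)[OF _ l0] by simp
    qed
    show "G_mod l \<subseteq> H l"
    proof
      fix x assume "x \<in> G_mod l"
      from G_hat_replace_component[OF l(1) g(1) this] obtain h where
        h: "h \<in> G_hat" "h l = x" "h m = rho id m" using m l(2) by metis
      hence "h \<in> rho_image" using im g(2) by simp
      thus "x \<in> H l" using h(2) by (auto simp: H_def)
    qed
  qed
qed

lemma (in curve_pair) euler_factor_bound: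
  assumes "full_preimage_level m" and "prime l" and "\<not> l dvd m"
    and "\<not> int l dvd T" and "l \<ge> 4"
  shows "\<bar>euler_factor T l - 1\<bar> \<le> 12 / real l ^ 2"
proof -
  \<comment> \<open>Since \<open>l\<close> does not divide \<open>T\<close>, the modulus in the
    Euler factor is \<open>l\<close> itself.\<close>
  have "multiplicity (int l) T = 0"
    using assms(4) by (rule not_dvd_imp_multiplicity_0)
  hence "euler_factor T l = real l * real (card (G_trace l T)) / real (card (G_mod l))"
    by (simp add: euler_factor_def H_trace_def G_trace_def H_eq_G_mod[OF assms(1-3)])
  thus ?thesis using G_trace_ratio_bound[OF assms(2,5), of T] by simp
qed

theorem proposition2p2p5:
  fixes E1 E2 :: "rat weierstrass"
    and B1 B2 :: "nat \<Rightarrow> 2 \<Rightarrow> qbar ec_point"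
    and mA :: nat
    and T :: int
  assumes "elliptic_curve E1" and "elliptic_curve E2"
    and "\<not> complex_multiplication (base_change E1)"
    and "\<not> complex_multiplication (base_change E2)"
    and "\<not> isogenous (base_change E1) (base_change E2)"
    and "tate_basis E1 B1" and "tate_basis E2 B2"
    and "curve_pair.is_conductor E1 E2 B1 B2 mA"
    and "T \<noteq> 0"
  shows "convergent_prod (\<lambda>l. if prime l \<and> \<not> l dvd mA
                              then curve_pair.euler_factor E1 E2 B1 B2 T l else 1)"
proof -
  let ?f = "\<lambda>l. if prime l \<and> \<not> l dvd mA then curve_pair.euler_factor E1 E2 B1 B2 T l else 1"
  have level: "curve_pair.full_preimage_level E1 E2 B1 B2 mA"
    using assms(8) by (simp add: curve_pair.is_conductor_def)
  \<comment> \<open>Absolute summability of the deviations from 1 gives convergence of the product.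
    Indices that are not primes, or that divide \<open>mA\<close>, contribute 0.\<close>
  have "summable (\<lambda>l. norm (?f l - 1))"
  proof (rule summable_comparison_test_ev)
    show "summable (\<lambda>l. 12 * inverse (real l ^ 2))"
      by (intro summable_mult inverse_power_summable) simp
    \<comment> \<open>As \<open>T\<close> is nonzero, every \<open>l\<close> beyond its absolute
      value fails to divide it; together with \<open>l \<ge> 4\<close> this puts all later primes
      not dividing \<open>mA\<close> under the bound for Euler factors.\<close>
    show "eventually (\<lambda>l. norm (norm (?f l - 1)) \<le> 12 * inverse (real l ^ 2)) sequentially"
      using eventually_ge_at_top[of 4] eventually_gt_at_top[of "nat \<bar>T\<bar>"]
    proof eventually_elim
      case (elim l)
      have "\<not> int l dvd T"
      proof
        assume "int l dvd T"
        from dvd_imp_le_int[OF assms(9) this] have "int l \<le> \<bar>T\<bar>" by simp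
        thus False using elim(2) by linarith
      qed
      with curve_pair.euler_factor_bound[OF level _ _ this elim(1)] show ?case
        by (simp add: divide_inverse)
    qed
  qed
  thus ?thesis
    by (intro abs_convergent_prod_imp_convergent_prod summable_imp_abs_convergent_prod)
qed

end
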